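(* The class of $\{-,\triangleright\}$-algebras that are completely representable by partial functions is axiomatised by the equations (Ax.1)–(Ax.5) together with the $\forall\exists\forall$ first-order formula stating that the algebra is atomic. Here, with $a\cdot b$ abbreviating $a-(a-b)$: (Ax.1) $a-(b-a)=a$; (Ax.2) $a\cdot b=b\cdot a$; (Ax.3) $(a-b)-c=(a-c)-b$; (Ax.4) $(a\triangleright c)\cdot(b\triangleright c)=(a\triangleright b)\triangleright c$; (Ax.5) $(a\cdot b)\triangleright a=a\cdot b$.
   Context: Partial functions, relative complement $f-g=\{(x,y)\in f\mid (x,y)\notin g\}$ and domain restriction $f\triangleright g=\{(x,y)\in g\mid x\in\mathrm{dom}(f)\}$ are as usual. A representation of a $\{-,\triangleright\}$-algebra $A$ by partial functions is an isomorphism $\theta$ from $A$ onto an algebra of partial functions (a set of partial functions on a base set $X$ closed under these operations), viewed as a map into the poset of all partial functions on $X$ ordered by inclusion. The order on $A$ is $a\le b\iff a\cdot b=a$. $\theta$ is meet complete if for every nonempty $S\subseteq A$ whose meet $\bigwedge S$ exists in $A$, $\theta(\bigwedge S)=\bigcap\theta[S]$; it is join complete if for every $S\subseteq A$ whose join $\bigvee S$ exists in $A$, $\bigcup\theta[S]$ is a partial function and equals $\theta(\bigvee S)$. A representation is complete if it is meet complete and join complete (for such representations these two conditions are equivalent), and $A$ is completely representable if it has a complete representation. For algebras satisfying (Ax.1)–(Ax.3), $0:=a-a$ (independent of $a$) is the least element; an atom is a minimal nonzero element, and the algebra is atomic if every nonzero element is above some atom. *)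

theory Defs
  imports "HOL-Algebra.Order"
begin

section \<open>Algebras of the signature with relative complement and domain restriction\<close>

record 'a dr_algebra = "'a partial_object" +
  diff :: "'a \<Rightarrow> 'a \<Rightarrow> 'a" (infixl "\<ominus>\<index>" 65)
  restr :: "'a \<Rightarrow> 'a \<Rightarrow> 'a" (infixl "\<triangleright>\<index>" 70)

text \<open>The empty algebra is not excluded.\<close>

locale dr_algebra =
  fixes A :: "'a dr_algebra" (structure)
  assumes diff_closed: "a \<in> carrier A \<Longrightarrow> b \<in> carrier A \<Longrightarrow> a \<ominus> b \<in> carrier A"
    and restr_closed: "a \<in> carrier A \<Longrightarrow> b \<in> carrier A \<Longrightarrow> a \<triangleright> b \<in> carrier A"

definition dr_meet :: "'a dr_algebra \<Rightarrow> 'a \<Rightarrow> 'a \<Rightarrow> 'a" where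
  "dr_meet A a b = a \<ominus>\<^bsub>A\<^esub> (a \<ominus>\<^bsub>A\<^esub> b)"

text \<open>The relation is a partial order only under suitable axioms (or for representable algebras);
  the record itself asserts nothing.\<close>

definition dr_order :: "'a dr_algebra \<Rightarrow> 'a gorder" where
  "dr_order A = \<lparr>carrier = carrier A, eq = (=), le = (\<lambda>a b. dr_meet A a b = a)\<rparr>"

abbreviation dr_le :: "'a dr_algebra \<Rightarrow> 'a \<Rightarrow> 'a \<Rightarrow> bool" where
  "dr_le A \<equiv> le (dr_order A)"

definition is_meet :: "'a dr_algebra \<Rightarrow> 'a set \<Rightarrow> 'a \<Rightarrow> bool" where
  "is_meet A S m \<longleftrightarrow> greatest (dr_order A) m (Lower (dr_order A) S)"

definition is_join :: "'a dr_algebra \<Rightarrow> 'a set \<Rightarrow> 'a \<Rightarrow> bool" where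
  "is_join A S j \<longleftrightarrow> least (dr_order A) j (Upper (dr_order A) S)"

text \<open>Meaningful when \<open>a \<ominus>\<^bsub>A\<^esub> a\<close> does not depend on \<open>a\<close>, and \<open>carrier A\<close> is nonempty.\<close>

definition dr_zero :: "'a dr_algebra \<Rightarrow> 'a" where
  "dr_zero A = (THE z. \<exists>a\<in>carrier A. z = a \<ominus>\<^bsub>A\<^esub> a)"

definition dr_atom :: "'a dr_algebra \<Rightarrow> 'a \<Rightarrow> bool" where
  "dr_atom A x \<longleftrightarrow> x \<in> carrier A \<and> x \<noteq> dr_zero A \<and>
     (\<forall>y\<in>carrier A. y \<noteq> dr_zero A \<and> dr_le A y x \<longrightarrow> y = x)"

definition dr_atomic :: "'a dr_algebra \<Rightarrow> bool" where
  "dr_atomic A \<longleftrightarrow>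
     (\<forall>a\<in>carrier A. a \<noteq> dr_zero A \<longrightarrow> (\<exists>x. dr_atom A x \<and> dr_le A x a))"

section \<open>Representations by partial functions\<close>

definition partial_function_on :: "'x set \<Rightarrow> ('x \<times> 'x) set \<Rightarrow> bool" where
  "partial_function_on X f \<longleftrightarrow> f \<subseteq> X \<times> X \<and> single_valued f"

definition dom_restrict :: "('x \<times> 'x) set \<Rightarrow> ('x \<times> 'x) set \<Rightarrow> ('x \<times> 'x) set" where
  "dom_restrict f g = {(x, y). (x, y) \<in> g \<and> x \<in> Domain f}"

text \<open>Relative complement of partial functions is set difference of their graphs.\<close>

definition pf_algebra :: "('x \<times> 'x) set set \<Rightarrow> ('x \<times> 'x) set dr_algebra" where
  "pf_algebra F = \<lparr>carrier = F, diff = (-), restr = dom_restrict\<rparr>"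

definition algebra_of_partial_functions :: "'x set \<Rightarrow> ('x \<times> 'x) set dr_algebra \<Rightarrow> bool" where
  "algebra_of_partial_functions X B \<longleftrightarrow>
     (\<exists>F. B = pf_algebra F \<and> (\<forall>f\<in>F. partial_function_on X f) \<and> dr_algebra B)"

definition dr_iso :: "'a dr_algebra \<Rightarrow> 'b dr_algebra \<Rightarrow> ('a \<Rightarrow> 'b) \<Rightarrow> bool" where
  "dr_iso A B \<theta> \<longleftrightarrow> bij_betw \<theta> (carrier A) (carrier B) \<and>
     (\<forall>a\<in>carrier A. \<forall>b\<in>carrier A.
        \<theta> (a \<ominus>\<^bsub>A\<^esub> b) = \<theta> a \<ominus>\<^bsub>B\<^esub> \<theta> b \<and> \<theta> (a \<triangleright>\<^bsub>A\<^esub> b) = \<theta> a \<triangleright>\<^bsub>B\<^esub> \<theta> b)"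

definition representation :: "'x set \<Rightarrow> 'a dr_algebra \<Rightarrow> ('a \<Rightarrow> ('x \<times> 'x) set) \<Rightarrow> bool" where
  "representation X A \<theta> \<longleftrightarrow> (\<exists>B. algebra_of_partial_functions X B \<and> dr_iso A B \<theta>)"

definition meet_complete :: "'a dr_algebra \<Rightarrow> ('a \<Rightarrow> ('x \<times> 'x) set) \<Rightarrow> bool" where
  "meet_complete A \<theta> \<longleftrightarrow>
     (\<forall>S m. S \<subseteq> carrier A \<and> S \<noteq> {} \<and> is_meet A S m \<longrightarrow> \<theta> m = \<Inter> (\<theta> ` S))"

definition join_complete :: "'x set \<Rightarrow> 'a dr_algebra \<Rightarrow> ('a \<Rightarrow> ('x \<times> 'x) set) \<Rightarrow> bool" where
  "join_complete X A \<theta> \<longleftrightarrow>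
     (\<forall>S j. S \<subseteq> carrier A \<and> is_join A S j \<longrightarrow>
        partial_function_on X (\<Union> (\<theta> ` S)) \<and> \<Union> (\<theta> ` S) = \<theta> j)"

definition complete_representation ::
    "'x set \<Rightarrow> 'a dr_algebra \<Rightarrow> ('a \<Rightarrow> ('x \<times> 'x) set) \<Rightarrow> bool" where
  "complete_representation X A \<theta> \<longleftrightarrow>
     representation X A \<theta> \<and> meet_complete A \<theta> \<and> join_complete X A \<theta>"

text \<open>HOL cannot quantify over types, so the type from which the points of the base set are drawn
  is a parameter. The element type of the algebra itself is large enough: the points can be taken
  to be atoms.\<close>

definition completely_representable :: "'x itself \<Rightarrow> 'a dr_algebra \<Rightarrow> bool" where
  "completely_representable _ A \<longleftrightarrow> (\<exists>(X :: 'x set) \<theta>. complete_representation X A \<theta>)"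

section \<open>First-order formulas of the signature\<close>

datatype dr_term =
    V nat
  | TDiff dr_term dr_term (infixl "\<^bold>-" 65)
  | TRestr dr_term dr_term (infixl "\<^bold>\<triangleright>" 70)

abbreviation TMeet :: "dr_term \<Rightarrow> dr_term \<Rightarrow> dr_term" (infixl "\<^bold>\<cdot>" 75) where
  "s \<^bold>\<cdot> t \<equiv> s \<^bold>- (s \<^bold>- t)"

datatype dr_form =
    Equ dr_term dr_term (infix "\<^bold>=" 50)
  | Neg dr_form ("\<^bold>\<not> _" [40] 40)
  | Con dr_form dr_form (infixr "\<^bold>\<and>" 35)
  | Dis dr_form dr_form (infixr "\<^bold>\<or>" 30)
  | Imp dr_form dr_form (infixr "\<^bold>\<longrightarrow>" 25)
  | Forall nat dr_form ("\<^bold>\<forall>_. _" [0, 10] 10)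
  | Exists nat dr_form ("\<^bold>\<exists>_. _" [0, 10] 10)

primrec tval :: "'a dr_algebra \<Rightarrow> (nat \<Rightarrow> 'a) \<Rightarrow> dr_term \<Rightarrow> 'a" where
  "tval A e (V n) = e n"
| "tval A e (s \<^bold>- t) = tval A e s \<ominus>\<^bsub>A\<^esub> tval A e t"
| "tval A e (s \<^bold>\<triangleright> t) = tval A e s \<triangleright>\<^bsub>A\<^esub> tval A e t"

primrec sat :: "'a dr_algebra \<Rightarrow> (nat \<Rightarrow> 'a) \<Rightarrow> dr_form \<Rightarrow> bool" where
  "sat A e (s \<^bold>= t) \<longleftrightarrow> tval A e s = tval A e t"
| "sat A e (\<^bold>\<not> \<phi>) \<longleftrightarrow> \<not> sat A e \<phi>"
| "sat A e (\<phi> \<^bold>\<and> \<psi>) \<longleftrightarrow> sat A e \<phi> \<and> sat A e \<psi>"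
| "sat A e (\<phi> \<^bold>\<or> \<psi>) \<longleftrightarrow> sat A e \<phi> \<or> sat A e \<psi>"
| "sat A e (\<phi> \<^bold>\<longrightarrow> \<psi>) \<longleftrightarrow> (sat A e \<phi> \<longrightarrow> sat A e \<psi>)"
| "sat A e (\<^bold>\<forall>n. \<phi>) \<longleftrightarrow> (\<forall>a\<in>carrier A. sat A (e(n := a)) \<phi>)"
| "sat A e (\<^bold>\<exists>n. \<phi>) \<longleftrightarrow> (\<exists>a\<in>carrier A. sat A (e(n := a)) \<phi>)"

text \<open>Free variables are read universally, as usual for equations.\<close>

definition models :: "'a dr_algebra \<Rightarrow> dr_form set \<Rightarrow> bool" where
  "models A T \<longleftrightarrow> (\<forall>\<phi>\<in>T. \<forall>e. range e \<subseteq> carrier A \<longrightarrow> sat A e \<phi>)"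

primrec quantifier_free :: "dr_form \<Rightarrow> bool" where
  "quantifier_free (s \<^bold>= t) \<longleftrightarrow> True"
| "quantifier_free (\<^bold>\<not> \<phi>) \<longleftrightarrow> quantifier_free \<phi>"
| "quantifier_free (\<phi> \<^bold>\<and> \<psi>) \<longleftrightarrow> quantifier_free \<phi> \<and> quantifier_free \<psi>"
| "quantifier_free (\<phi> \<^bold>\<or> \<psi>) \<longleftrightarrow> quantifier_free \<phi> \<and> quantifier_free \<psi>"
| "quantifier_free (\<phi> \<^bold>\<longrightarrow> \<psi>) \<longleftrightarrow> quantifier_free \<phi> \<and> quantifier_free \<psi>"
| "quantifier_free (\<^bold>\<forall>n. \<phi>) \<longleftrightarrow> False"
| "quantifier_free (\<^bold>\<exists>n. \<phi>) \<longleftrightarrow> False"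

definition forall_exists_forall :: "dr_form \<Rightarrow> bool" where
  "forall_exists_forall \<phi> \<longleftrightarrow>
     (\<exists>xs ys zs \<psi>. quantifier_free \<psi> \<and> \<phi> = foldr Forall xs (foldr Exists ys (foldr Forall zs \<psi>)))"

definition Ax1 :: dr_form where
  "Ax1 = (let a = V 0; b = V 1 in a \<^bold>- (b \<^bold>- a) \<^bold>= a)"

definition Ax2 :: dr_form where
  "Ax2 = (let a = V 0; b = V 1 in a \<^bold>\<cdot> b \<^bold>= b \<^bold>\<cdot> a)"

definition Ax3 :: dr_form where
  "Ax3 = (let a = V 0; b = V 1; c = V 2 in (a \<^bold>- b) \<^bold>- c \<^bold>= (a \<^bold>- c) \<^bold>- b)"

definition Ax4 :: dr_form where
  "Ax4 = (let a = V 0; b = V 1; c = V 2 in (a \<^bold>\<triangleright> c) \<^bold>\<cdot> (b \<^bold>\<triangleright> c) \<^bold>= (a \<^bold>\<triangleright> b) \<^bold>\<triangleright> c)"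

definition Ax5 :: dr_form where
  "Ax5 = (let a = V 0; b = V 1 in (a \<^bold>\<cdot> b) \<^bold>\<triangleright> a \<^bold>= a \<^bold>\<cdot> b)"

text \<open>Every \<open>a\<close> is zero or has an atom \<open>x\<close> below it. The constant \<open>0\<close> is not in the signature, so
  \<open>t = 0\<close> is expressed by \<open>t = t - t\<close>.\<close>

definition Atomic_form :: dr_form where
  "Atomic_form = (let a = V 0; x = V 1; y = V 2 in
     \<^bold>\<forall>0. \<^bold>\<exists>1. \<^bold>\<forall>2.
       (\<^bold>\<not> (a \<^bold>= a \<^bold>- a)) \<^bold>\<longrightarrow>
         (\<^bold>\<not> (x \<^bold>= x \<^bold>- x)) \<^bold>\<and> (x \<^bold>\<cdot> a \<^bold>= x) \<^bold>\<and>
         ((\<^bold>\<not> (y \<^bold>= y \<^bold>- y)) \<^bold>\<and> (y \<^bold>\<cdot> x \<^bold>= y) \<^bold>\<longrightarrow> (y \<^bold>= x)))"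

end

theory Submission
  imports Defs
begin

text \<open>Represent \<open>a\<close> by the pairs \<open>([x], x)\<close> with \<open>x\<close> an atom below \<open>a\<close>, where \<open>[x]\<close> is the class of
  \<open>x\<close> under the relation \<open>x \<triangleright> y = y\<close> ("same domain"), replaced by a chosen representative so that
  the points stay in the element type. (Ax.4) and (Ax.5) make this relation an equivalence on atoms
  and make distinct atoms below a common \<open>a\<close> inequivalent, so the images are partial functions. As an
  atom lies below a join only if it lies below a joinand, the representation is complete.
  Conversely, under a complete representation the elements below \<open>a\<close> whose image contains a fixed
  pair of \<open>\<theta> a\<close> have a nonzero lower bound, which is an atom.\<close>

section \<open>Subtraction algebras\<close>

lemma dr_le_iff: "dr_le A a b \<longleftrightarrow> dr_meet A a b = a"
  by (simp add: dr_order_def)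

lemma carrier_dr_order [simp]: "carrier (dr_order A) = carrier A"
  by (simp add: dr_order_def)

lemma is_meet_iff:
  assumes "S \<subseteq> carrier A"
  shows "is_meet A S m \<longleftrightarrow> m \<in> carrier A \<and> (\<forall>s\<in>S. dr_le A m s) \<and>
           (\<forall>l\<in>carrier A. (\<forall>s\<in>S. dr_le A l s) \<longrightarrow> dr_le A l m)"
proof -
  have "Lower (dr_order A) S = {l \<in> carrier A. \<forall>s\<in>S. dr_le A l s}"
    using assms by (auto simp: Lower_def)
  then show ?thesis by (auto simp: is_meet_def greatest_def)
qed

lemma is_join_iff:
  assumes "S \<subseteq> carrier A"
  shows "is_join A S j \<longleftrightarrow> j \<in> carrier A \<and> (\<forall>s\<in>S. dr_le A s j) \<and>
           (\<forall>u\<in>carrier A. (\<forall>s\<in>S. dr_le A s u) \<longrightarrow> dr_le A j u)"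
proof -
  have "Upper (dr_order A) S = {u \<in> carrier A. \<forall>s\<in>S. dr_le A s u}"
    using assms by (auto simp: Upper_def)
  then show ?thesis by (auto simp: is_join_def least_def)
qed

text \<open>Kept apart from the axioms on restriction because the theorem relates
  \<open>Atomic_form\<close> to atomicity for every algebra satisfying the first three
  axioms.\<close>

locale subtraction_algebra = dr_algebra A for A :: "'a dr_algebra" (structure) +
  assumes ax1: "a \<in> carrier A \<Longrightarrow> b \<in> carrier A \<Longrightarrow> a \<ominus> (b \<ominus> a) = a"
    and ax2: "a \<in> carrier A \<Longrightarrow> b \<in> carrier A \<Longrightarrow> dr_meet A a b = dr_meet A b a"
    and ax3: "a \<in> carrier A \<Longrightarrow> b \<in> carrier A \<Longrightarrow> c \<in> carrier A \<Longrightarrow>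
                (a \<ominus> b) \<ominus> c = (a \<ominus> c) \<ominus> b"
begin

abbreviation zero ("\<zero>") where "\<zero> \<equiv> dr_zero A"
abbreviation meet (infixl "\<sqinter>" 75) where "a \<sqinter> b \<equiv> dr_meet A a b"
abbreviation leq (infix "\<preceq>" 50) where "a \<preceq> b \<equiv> dr_le A a b"

lemma meet_closed: "a \<in> carrier A \<Longrightarrow> b \<in> carrier A \<Longrightarrow> a \<sqinter> b \<in> carrier A"
  by (simp add: dr_meet_def diff_closed)

lemmas closed = diff_closed restr_closed meet_closed

text \<open>By \<open>ax1\<close>, \<open>a\<close> and \<open>b \<ominus> a\<close> are each
  unchanged by subtracting the other. The two sides are therefore their meet, computed in the two
  orders.\<close>

lemma diff_self_diff:
  assumes "a \<in> carrier A" "b \<in> carrier A"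
  shows "(b \<ominus> a) \<ominus> (b \<ominus> a) = a \<ominus> a"
proof -
  have "(b \<ominus> a) \<ominus> a = b \<ominus> a"
    using assms ax1 [of "b \<ominus> a" a] ax1 [of a b] diff_closed by simp
  then show ?thesis
    using assms ax1 [of a b] ax2 [of a "b \<ominus> a"] diff_closed by (simp add: dr_meet_def)
qed

text \<open>Write d(x) for \<open>x \<ominus> x\<close>. The preceding lemma, used twice on each
  side, gives d(a) = d(b - a) = d(b meet a) and d(b) = d(a - b) = d(a meet b), and meets
  commute.\<close>

lemma diff_self_unique: "a \<in> carrier A \<Longrightarrow> b \<in> carrier A \<Longrightarrow> a \<ominus> a = b \<ominus> b"
  using diff_self_diff [of "a \<ominus> b" a] diff_self_diff [of "b \<ominus> a" b] diff_self_diff [of a b]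
    diff_self_diff [of b a] ax2 [of a b]
  by (simp add: diff_closed dr_meet_def)

lemma diff_self: "a \<in> carrier A \<Longrightarrow> a \<ominus> a = \<zero>"
  unfolding dr_zero_def by (rule the_equality [symmetric]) (auto intro: diff_self_unique)

lemma zero_closed: "a \<in> carrier A \<Longrightarrow> \<zero> \<in> carrier A"
  using diff_closed diff_self by metis

lemma diff_zero: "a \<in> carrier A \<Longrightarrow> a \<ominus> \<zero> = a"
  using ax1 diff_self by metis

lemma diff_diff_left: "a \<in> carrier A \<Longrightarrow> b \<in> carrier A \<Longrightarrow> (a \<ominus> b) \<ominus> a = \<zero>"
  using ax1 ax3 diff_self diff_closed by metis

lemma zero_diff: "a \<in> carrier A \<Longrightarrow> \<zero> \<ominus> a = \<zero>"
  using diff_diff_left diff_self ax3 by metis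

text \<open>If \<open>a \<ominus> (a \<ominus> b) = a\<close>, then \<open>ax1\<close> yields
  \<open>a \<ominus> b = (a \<ominus> b) \<ominus> a\<close>, which is zero. The converse is
  \<open>diff_zero\<close>.\<close>

lemma le_iff_diff: "a \<in> carrier A \<Longrightarrow> b \<in> carrier A \<Longrightarrow> a \<preceq> b \<longleftrightarrow> a \<ominus> b = \<zero>"
  unfolding dr_le_iff dr_meet_def using ax1 diff_closed diff_self diff_zero diff_diff_left by metis

lemma le_refl: "a \<in> carrier A \<Longrightarrow> a \<preceq> a"
  by (simp add: le_iff_diff diff_self)

lemma le_antisym: "a \<in> carrier A \<Longrightarrow> b \<in> carrier A \<Longrightarrow> a \<preceq> b \<Longrightarrow> b \<preceq> a \<Longrightarrow> a = b"
  unfolding dr_le_iff using ax2 by metis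

lemma le_trans:
  assumes "a \<in> carrier A" "b \<in> carrier A" "c \<in> carrier A" "a \<preceq> b" "b \<preceq> c"
  shows "a \<preceq> c"
proof -
  \<comment> \<open>An element below \<open>b\<close> is a complement within \<open>b\<close>, so
    \<open>ax3\<close> lets a further subtraction act on \<open>b\<close> first. The same device
    serves in \<open>diff_mono_left\<close> and \<open>le_diff_iff\<close>.\<close>
  have "a = b \<ominus> (b \<ominus> a)"
    using assms ax2 unfolding dr_le_iff dr_meet_def by metis
  then have "a \<ominus> c = (b \<ominus> c) \<ominus> (b \<ominus> a)"
    using ax3 assms diff_closed by metis
  then show ?thesis
    using assms zero_diff diff_closed by (simp add: le_iff_diff)
qed

lemma zero_le: "a \<in> carrier A \<Longrightarrow> \<zero> \<preceq> a"
  by (metis zero_closed le_iff_diff zero_diff)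

lemma le_zero: "a \<in> carrier A \<Longrightarrow> a \<preceq> \<zero> \<longleftrightarrow> a = \<zero>"
  by (metis zero_closed zero_le le_antisym)

lemma diff_le: "a \<in> carrier A \<Longrightarrow> b \<in> carrier A \<Longrightarrow> a \<ominus> b \<preceq> a"
  by (simp add: le_iff_diff diff_diff_left diff_closed)

lemma meet_le1: "a \<in> carrier A \<Longrightarrow> b \<in> carrier A \<Longrightarrow> a \<sqinter> b \<preceq> a"
  by (simp add: dr_meet_def diff_le diff_closed)

lemma meet_le2: "a \<in> carrier A \<Longrightarrow> b \<in> carrier A \<Longrightarrow> a \<sqinter> b \<preceq> b"
  using ax2 meet_le1 by metis

lemma diff_mono_left:
  assumes "a \<in> carrier A" "b \<in> carrier A" "c \<in> carrier A" "a \<preceq> b"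
  shows "a \<ominus> c \<preceq> b \<ominus> c"
proof -
  have "a \<ominus> c = (b \<ominus> c) \<ominus> (b \<ominus> a)"
    using assms ax2 ax3 diff_closed unfolding dr_le_iff dr_meet_def by metis
  then show ?thesis
    using assms by (simp add: diff_le diff_closed)
qed

text \<open>If \<open>c\<close> lies below \<open>a \<ominus> b\<close>, it is a complement within
  \<open>a \<ominus> b\<close>; that element absorbs a subtraction of \<open>b\<close>, hence so
  does \<open>c\<close>. Conversely, disjointness gives \<open>c \<preceq> c \<ominus> b\<close>,
  and \<open>c \<ominus> b \<preceq> a \<ominus> b\<close> by monotonicity.\<close>

lemma le_diff_iff:
  assumes "a \<in> carrier A" "b \<in> carrier A" "c \<in> carrier A"
  shows "c \<preceq> a \<ominus> b \<longleftrightarrow> c \<preceq> a \<and> c \<sqinter> b = \<zero>"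
proof
  assume le: "c \<preceq> a \<ominus> b"
  have c: "c = (a \<ominus> b) \<ominus> ((a \<ominus> b) \<ominus> c)"
    using assms le ax2 diff_closed unfolding dr_le_iff dr_meet_def by metis
  have "(a \<ominus> b) \<ominus> b = a \<ominus> b"
    using assms ax1 diff_closed by metis
  then have "c \<ominus> b = c"
    using c assms ax3 diff_closed by metis
  then show "c \<preceq> a \<and> c \<sqinter> b = \<zero>"
    using assms le le_trans diff_le diff_closed diff_self unfolding dr_meet_def by metis
next
  assume "c \<preceq> a \<and> c \<sqinter> b = \<zero>"
  then have "c \<preceq> c \<ominus> b" "c \<ominus> b \<preceq> a \<ominus> b"
    using assms by (simp_all add: le_iff_diff diff_closed dr_meet_def)
      (metis assms le_iff_diff diff_closed diff_mono_left)
  then show "c \<preceq> a \<ominus> b"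
    using assms le_trans diff_closed by metis
qed

section \<open>Atoms of a subtraction algebra\<close>

lemma atomD:
  assumes "dr_atom A x"
  shows "x \<in> carrier A" "x \<noteq> \<zero>" "y \<in> carrier A \<Longrightarrow> y \<preceq> x \<Longrightarrow> y = \<zero> \<or> y = x"
  using assms by (auto simp: dr_atom_def)

text \<open>The meet of an atom with \<open>b\<close> is zero or the atom itself, so for atoms being
  disjoint from \<open>b\<close> is the same as not lying below \<open>b\<close>. Atoms thus behave
  like points of a set.\<close>

lemma atom_le_diff_iff:
  assumes "dr_atom A x" "a \<in> carrier A" "b \<in> carrier A"
  shows "x \<preceq> a \<ominus> b \<longleftrightarrow> x \<preceq> a \<and> \<not> x \<preceq> b"
  using assms le_diff_iff atomD meet_closed meet_le1 unfolding dr_le_iff by metis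

text \<open>If \<open>a\<close> is not below \<open>b\<close>, then \<open>a \<ominus> b\<close> is
  nonzero, and an atom below it separates the two. This yields injectivity of the
  representation.\<close>

lemma le_by_atoms:
  assumes "dr_atomic A" "a \<in> carrier A" "b \<in> carrier A"
    and "\<And>x. dr_atom A x \<Longrightarrow> x \<preceq> a \<Longrightarrow> x \<preceq> b"
  shows "a \<preceq> b"
proof (rule ccontr)
  assume "\<not> a \<preceq> b"
  then obtain x where "dr_atom A x" "x \<preceq> a \<ominus> b"
    using assms diff_closed unfolding dr_atomic_def by (metis le_iff_diff)
  then show False
    using assms atom_le_diff_iff by blast
qed

end

section \<open>Atoms and domain restriction\<close>

locale difference_restriction_algebra = subtraction_algebra +
  assumes ax4: "a \<in> carrier A \<Longrightarrow> b \<in> carrier A \<Longrightarrow> c \<in> carrier A \<Longrightarrow>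
                  dr_meet A (a \<triangleright> c) (b \<triangleright> c) = (a \<triangleright> b) \<triangleright> c"
    and ax5: "a \<in> carrier A \<Longrightarrow> b \<in> carrier A \<Longrightarrow> dr_meet A a b \<triangleright> a = dr_meet A a b"
begin

section \<open>Restriction and the order\<close>

lemma restr_eq_if_le: "a \<in> carrier A \<Longrightarrow> b \<in> carrier A \<Longrightarrow> a \<preceq> b \<Longrightarrow> a \<triangleright> b = a"
  unfolding dr_le_iff using ax2 ax5 by metis

lemma restr_self: "a \<in> carrier A \<Longrightarrow> a \<triangleright> a = a"
  by (simp add: restr_eq_if_le le_refl)

lemma restr_meet_right:
  assumes "a \<in> carrier A" "c \<in> carrier A"
  shows "(a \<triangleright> c) \<triangleright> c = (a \<triangleright> c) \<sqinter> c"
  using assms ax4 restr_self by metis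

text \<open>With \<open>d = a \<triangleright> c\<close> and
  \<open>f = d \<sqinter> c = d \<triangleright> c\<close>, evaluate
  \<open>f \<triangleright> d\<close> twice. It is \<open>f\<close> because
  \<open>f \<preceq> d\<close>; by \<open>ax4\<close> it is the meet of
  \<open>d \<triangleright> d\<close> with \<open>c \<triangleright> d\<close>, which is
  \<open>d\<close> because \<open>d \<triangleright> d\<close> is itself a meet with
  \<open>c \<triangleright> d\<close>. Hence \<open>d = d \<sqinter> c\<close>.\<close>

lemma restr_le:
  assumes "a \<in> carrier A" "c \<in> carrier A"
  shows "a \<triangleright> c \<preceq> c"
proof -
  define d where "d = a \<triangleright> c"
  define f where "f = d \<sqinter> c"
  have [simp]: "d \<in> carrier A" "f \<in> carrier A"
    using assms by (simp_all add: d_def f_def closed)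
  have f: "f = d \<triangleright> c"
    using assms restr_meet_right by (simp add: f_def d_def)
  have dd: "d \<triangleright> d = (a \<triangleright> d) \<sqinter> (c \<triangleright> d)"
    using assms ax4 [of a c d] by (simp add: d_def closed)
  have "f \<triangleright> d = (d \<triangleright> d) \<sqinter> (c \<triangleright> d)"
    using assms ax4 [of d c d] by (simp add: f)
  also have "\<dots> = d \<triangleright> d"
    using assms meet_le2 [of "a \<triangleright> d" "c \<triangleright> d"] by (simp add: dd restr_closed dr_le_iff)
  finally have "f \<triangleright> d = d"
    by (simp add: restr_self)
  moreover have "f \<triangleright> d = f"
    using assms by (simp add: f_def restr_eq_if_le meet_le1 closed)
  ultimately show ?thesis
    by (simp add: d_def f_def dr_le_iff)
qed

lemma restr_restr_left:
  assumes "a \<in> carrier A" "b \<in> carrier A"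
  shows "(a \<triangleright> b) \<triangleright> b = a \<triangleright> b"
  using assms restr_le restr_eq_if_le restr_closed by metis

lemma restr_restr_swap:
  assumes "a \<in> carrier A" "b \<in> carrier A" "c \<in> carrier A"
  shows "(a \<triangleright> b) \<triangleright> c = (b \<triangleright> a) \<triangleright> c"
  using assms ax4 ax2 restr_closed by metis

lemma restr_mono_left:
  assumes "a \<in> carrier A" "b \<in> carrier A" "c \<in> carrier A" "a \<preceq> b"
  shows "a \<triangleright> c \<preceq> b \<triangleright> c"
  using assms ax4 restr_eq_if_le meet_le2 restr_closed by metis

text \<open>Everything in sight is below \<open>c\<close> and so is fixed by restricting
  \<open>c\<close> to it. After this rewriting, \<open>ax4\<close> turns both sides into the meet of
  \<open>a \<triangleright> c\<close> and \<open>b \<triangleright> c\<close>.\<close>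

lemma restr_assoc:
  assumes "a \<in> carrier A" "b \<in> carrier A" "c \<in> carrier A"
  shows "a \<triangleright> (b \<triangleright> c) = (a \<triangleright> b) \<triangleright> c"
proof -
  have "a \<triangleright> (b \<triangleright> c) \<preceq> c"
    using assms restr_le restr_closed le_trans by metis
  then have "a \<triangleright> (b \<triangleright> c) = (a \<triangleright> (b \<triangleright> c)) \<triangleright> c"
    using assms restr_eq_if_le restr_closed by metis
  also have "\<dots> = (a \<triangleright> b) \<triangleright> c"
    using assms ax4 restr_closed restr_restr_left by metis
  finally show ?thesis .
qed

text \<open>Since \<open>b = b \<triangleright> c\<close>, associativity and \<open>ax4\<close> make
  \<open>a \<triangleright> b\<close> the meet of \<open>a \<triangleright> c\<close> and
  \<open>b \<triangleright> c\<close>.\<close>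

lemma restr_mono_right:
  assumes "a \<in> carrier A" "b \<in> carrier A" "c \<in> carrier A" "b \<preceq> c"
  shows "a \<triangleright> b \<preceq> a \<triangleright> c"
  using assms ax4 restr_assoc restr_eq_if_le meet_le1 restr_closed by metis

lemma zero_restr: "a \<in> carrier A \<Longrightarrow> \<zero> \<triangleright> a = \<zero>"
  using restr_eq_if_le zero_closed zero_le by metis

text \<open>For arbitrary partial functions this equation says only that the domain of
  \<open>y\<close> lies in that of \<open>x\<close>; between atoms it is symmetric.\<close>

abbreviation same_domain (infix "\<asymp>" 50) where "x \<asymp> y \<equiv> x \<triangleright> y = y"

lemma same_domain_atoms_iff:
  assumes "dr_atom A y" "x \<in> carrier A"
  shows "x \<asymp> y \<longleftrightarrow> x \<triangleright> y \<noteq> \<zero>"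
  using assms atomD restr_le restr_closed by metis

text \<open>Swapping inside the left argument gives
  \<open>(y \<triangleright> x) \<triangleright> y = y\<close>, which is nonzero. So
  \<open>y \<triangleright> x\<close> is nonzero and, \<open>x\<close> being an atom, equals
  \<open>x\<close>.\<close>

lemma same_domain_sym:
  assumes "dr_atom A x" "dr_atom A y" "x \<asymp> y"
  shows "y \<asymp> x"
proof -
  have c: "x \<in> carrier A" "y \<in> carrier A"
    using assms atomD by auto
  then have "(y \<triangleright> x) \<triangleright> y = y"
    using assms restr_restr_swap restr_self by metis
  then have "y \<triangleright> x \<noteq> \<zero>"
    using assms c atomD zero_restr by metis
  then show ?thesis
    using assms c same_domain_atoms_iff by blast
qed

lemma same_domain_trans:
  assumes "x \<in> carrier A" "y \<in> carrier A" "z \<in> carrier A" "x \<asymp> y" "y \<asymp> z"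
  shows "x \<asymp> z"
  using assms restr_assoc by metis

text \<open>Both atoms are restrictions of \<open>a\<close>, so \<open>ax4\<close> turns their meet
  into \<open>(x \<triangleright> y) \<triangleright> a = y \<triangleright> a = y\<close>. This
  makes the images of elements single-valued.\<close>

lemma same_domain_below_eq:
  assumes "dr_atom A x" "dr_atom A y" "a \<in> carrier A" "x \<preceq> a" "y \<preceq> a" "x \<asymp> y"
  shows "x = y"
proof -
  have c: "x \<in> carrier A" "y \<in> carrier A"
    using assms atomD by auto
  have "x \<sqinter> y = (x \<triangleright> y) \<triangleright> a"
    using assms c ax4 restr_eq_if_le by metis
  then have "y \<preceq> x"
    using assms c restr_eq_if_le meet_le1 by metis
  then show ?thesis
    using assms c atomD by metis
qed

text \<open>From left to right, \<open>x = (x \<triangleright> a) \<triangleright> b\<close> shows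
  that \<open>x \<triangleright> a\<close> is nonzero, and any atom below it serves as
  \<open>y\<close>. From right to left, \<open>x = y \<triangleright> x\<close> lies below
  \<open>a \<triangleright> x\<close>, hence below \<open>a \<triangleright> b\<close>.\<close>

lemma atom_le_restr_iff:
  assumes "dr_atomic A" "dr_atom A x" and ab: "a \<in> carrier A" "b \<in> carrier A"
  shows "x \<preceq> a \<triangleright> b \<longleftrightarrow> x \<preceq> b \<and> (\<exists>y. dr_atom A y \<and> y \<preceq> a \<and> y \<asymp> x)"
proof
  have x: "x \<in> carrier A"
    using assms atomD by auto
  {
    assume le: "x \<preceq> a \<triangleright> b"
    then have xb: "x \<preceq> b"
      using ab x restr_le le_trans restr_closed by metis
    have "x = x \<triangleright> (a \<triangleright> b)"
      using le ab x restr_eq_if_le restr_closed by metis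
    also have "\<dots> = (x \<triangleright> a) \<triangleright> b"
      using ab x by (simp add: restr_assoc)
    finally have "x \<triangleright> a \<noteq> \<zero>"
      using assms atomD zero_restr by metis
    then obtain y where y: "dr_atom A y" "y \<preceq> x \<triangleright> a"
      using assms x restr_closed unfolding dr_atomic_def by blast
    have yc: "y \<in> carrier A"
      using y atomD by blast
    have ya: "y \<preceq> a"
      using y(2) yc ab x restr_le le_trans restr_closed by metis
    have "y = y \<triangleright> (x \<triangleright> a)"
      using y yc ab x restr_eq_if_le restr_closed by metis
    also have "\<dots> = (x \<triangleright> y) \<triangleright> a"
      using yc ab x restr_assoc restr_restr_swap by metis
    finally have "x \<triangleright> y \<noteq> \<zero>"
      using y atomD zero_restr ab by metis
    then show "x \<preceq> b \<and> (\<exists>y. dr_atom A y \<and> y \<preceq> a \<and> y \<asymp> x)"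
      using xb ya y(1) same_domain_sym [OF assms(2) y(1)] same_domain_atoms_iff [OF y(1) x] by blast
  }
  {
    assume "x \<preceq> b \<and> (\<exists>y. dr_atom A y \<and> y \<preceq> a \<and> y \<asymp> x)"
    then obtain y where y: "dr_atom A y" "y \<preceq> a" "y \<asymp> x" and xb: "x \<preceq> b"
      by blast
    then have yc: "y \<in> carrier A"
      using atomD by blast
    have "x \<preceq> a \<triangleright> x"
      using y yc x ab restr_mono_left by metis
    then show "x \<preceq> a \<triangleright> b"
      using xb x ab restr_mono_right restr_closed le_trans by metis
  }
qed

section \<open>The representation by atoms\<close>

definition domain_rep :: "'a \<Rightarrow> 'a" where
  "domain_rep x = (SOME y. dr_atom A y \<and> y \<asymp> x)"

lemma domain_rep_eq_iff:
  assumes "dr_atom A x" "dr_atom A y"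
  shows "domain_rep x = domain_rep y \<longleftrightarrow> x \<asymp> y"
proof
  have rep: "dr_atom A (domain_rep z) \<and> domain_rep z \<asymp> z" if "dr_atom A z" for z
    unfolding domain_rep_def
    by (rule someI [of _ z]) (simp add: that atomD restr_self)
  show "x \<asymp> y" if "domain_rep x = domain_rep y"
    using that rep assms atomD same_domain_sym same_domain_trans by metis
  show "domain_rep x = domain_rep y" if "x \<asymp> y"
  proof -
    \<comment> \<open>Equivalent atoms satisfy the same choice predicate, so \<open>SOME\<close>
      selects the same element for both.\<close>
    have "(dr_atom A z \<and> z \<asymp> x) = (dr_atom A z \<and> z \<asymp> y)" for z
      using that assms atomD same_domain_sym same_domain_trans by metis
    then show ?thesis
      by (simp add: domain_rep_def)
  qed
qed

definition atom_rep :: "'a \<Rightarrow> ('a \<times> 'a) set" where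
  "atom_rep a = {(domain_rep x, x) | x. dr_atom A x \<and> x \<preceq> a}"

lemma in_atom_rep_iff: "(p, x) \<in> atom_rep a \<longleftrightarrow> p = domain_rep x \<and> dr_atom A x \<and> x \<preceq> a"
  by (auto simp: atom_rep_def)

lemma single_valued_atom_rep:
  assumes "a \<in> carrier A"
  shows "single_valued (atom_rep a)"
  unfolding single_valued_def in_atom_rep_iff
  using assms domain_rep_eq_iff same_domain_below_eq by metis

lemma atom_rep_diff:
  assumes "a \<in> carrier A" "b \<in> carrier A"
  shows "atom_rep (a \<ominus> b) = atom_rep a - atom_rep b"
  using assms atom_le_diff_iff by (auto simp: in_atom_rep_iff)

lemma atom_rep_restr:
  assumes "dr_atomic A" "a \<in> carrier A" "b \<in> carrier A"
  shows "atom_rep (a \<triangleright> b) = dom_restrict (atom_rep a) (atom_rep b)"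
proof -
  have "domain_rep x \<in> Domain (atom_rep a) \<longleftrightarrow> (\<exists>y. dr_atom A y \<and> y \<preceq> a \<and> y \<asymp> x)"
    if "dr_atom A x" for x
    using that domain_rep_eq_iff unfolding Domain_iff in_atom_rep_iff by metis
  then have "(p, x) \<in> atom_rep (a \<triangleright> b) \<longleftrightarrow> (p, x) \<in> dom_restrict (atom_rep a) (atom_rep b)" for p x
    using assms
    by (simp add: dom_restrict_def in_atom_rep_iff atom_le_restr_iff cong: conj_cong)
  then show ?thesis
    by (intro equalityI subrelI) simp_all
qed

lemma inj_atom_rep:
  assumes "dr_atomic A"
  shows "inj_on atom_rep (carrier A)"
proof (rule inj_onI)
  fix a b assume ab: "a \<in> carrier A" "b \<in> carrier A" "atom_rep a = atom_rep b"
  then have "x \<preceq> a \<longleftrightarrow> x \<preceq> b" if "dr_atom A x" for x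
    using that in_atom_rep_iff by metis
  then show "a = b"
    using ab(1,2) le_antisym le_by_atoms [OF assms] by blast
qed

lemma representation_atom_rep:
  assumes "dr_atomic A"
  shows "representation UNIV A atom_rep"
proof -
  let ?B = "pf_algebra (atom_rep ` carrier A)"
  have "dr_algebra ?B"
    using assms
    by unfold_locales
      (auto simp: pf_algebra_def simp flip: atom_rep_diff atom_rep_restr intro!: imageI closed)
  then have "algebra_of_partial_functions UNIV ?B"
    using single_valued_atom_rep
    by (auto simp: algebra_of_partial_functions_def partial_function_on_def)
  moreover have "dr_iso A ?B atom_rep"
    using assms inj_atom_rep atom_rep_diff atom_rep_restr
    by (simp add: dr_iso_def pf_algebra_def bij_betw_def)
  ultimately show ?thesis
    unfolding representation_def by blast
qed

section \<open>Completeness of the representation by atoms\<close>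

lemma meet_complete_atom_rep: "meet_complete A atom_rep"
proof -
  have "atom_rep m = \<Inter> (atom_rep ` S)" if S: "S \<subseteq> carrier A" "S \<noteq> {}" "is_meet A S m" for S m
  proof -
    have "x \<preceq> m \<longleftrightarrow> (\<forall>s\<in>S. x \<preceq> s)" if "dr_atom A x" for x
      using S that atomD(1) le_trans [of x m] unfolding is_meet_iff [OF S(1)] by blast
    \<comment> \<open>A member of \<open>S\<close> is needed for the pairs in the intersection to
      have the form \<open>(domain_rep x, x)\<close> with \<open>x\<close> an atom.\<close>
    then show ?thesis
      using S(2) by (auto simp: in_atom_rep_iff)
  qed
  then show ?thesis
    by (simp add: meet_complete_def)
qed

lemma join_complete_atom_rep: "join_complete UNIV A atom_rep"
proof -
  \<comment> \<open>Membership of \<open>j\<close> in the carrier is carried along so that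
    \<open>single_valued_atom_rep\<close> makes the union a partial function.\<close>
  have "\<Union> (atom_rep ` S) = atom_rep j \<and> j \<in> carrier A" if S: "S \<subseteq> carrier A" "is_join A S j" for S j
  proof -
    note j = S(2) [unfolded is_join_iff [OF S(1)]]
    have "x \<preceq> j \<longleftrightarrow> (\<exists>s\<in>S. x \<preceq> s)" if x: "dr_atom A x" for x
    proof
      note xc = atomD(1) [OF x]
      show "x \<preceq> j" if "\<exists>s\<in>S. x \<preceq> s"
        using that xc S(1) j le_trans [of x _ j] by blast
      assume "x \<preceq> j"
      show "\<exists>s\<in>S. x \<preceq> s"
      proof (rule ccontr)
        assume none: "\<not> (\<exists>s\<in>S. x \<preceq> s)"
        \<comment> \<open>An atom below no joinand is disjoint from each of them. Then
          \<open>j \<ominus> x\<close> is an upper bound too, so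
          \<open>x \<preceq> j \<preceq> j \<ominus> x\<close>, which is absurd.\<close>
        have "s \<preceq> j \<ominus> x" if "s \<in> S" for s
        proof -
          have s: "s \<in> carrier A" "\<not> x \<preceq> s"
            using that S(1) none by auto
          have "x \<sqinter> s = \<zero>"
            using s x xc atomD(3) meet_le1 meet_closed dr_le_iff by metis
          then show ?thesis
            using s xc j that ax2 le_diff_iff by metis
        qed
        then have "j \<preceq> j \<ominus> x"
          using j xc diff_closed by blast
        then have "x \<preceq> j \<ominus> x"
          using \<open>x \<preceq> j\<close> xc j le_trans diff_closed by metis
        then show False
          using x xc j atom_le_diff_iff le_refl by blast
      qed
    qed
    then show ?thesis
      using j by (auto simp: in_atom_rep_iff)
  qed
  then show ?thesis
    using single_valued_atom_rep by (auto simp: join_complete_def partial_function_on_def)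
qed

end

section \<open>Axioms as formulas\<close>

text \<open>Two explicit insertions keep the rewriting from splitting a singleton again.\<close>

lemma models_insert2:
  "models A (insert \<phi> (insert \<psi> T)) \<longleftrightarrow> models A {\<phi>} \<and> models A (insert \<psi> T)"
  by (auto simp: models_def)

lemma models_singleton: "models A {\<phi>} \<longleftrightarrow> (\<forall>e. range e \<subseteq> carrier A \<longrightarrow> sat A e \<phi>)"
  by (simp add: models_def)

lemma all_valuations_iff:
  "(\<forall>e. range e \<subseteq> carrier A \<longrightarrow> P (e 0) (e 1) (e (2::nat))) \<longleftrightarrow>
     (\<forall>a\<in>carrier A. \<forall>b\<in>carrier A. \<forall>c\<in>carrier A. P a b c)"
proof (intro iffI ballI allI impI)
  fix a b c
  assume e: "\<forall>e. range e \<subseteq> carrier A \<longrightarrow> P (e 0) (e 1) (e (2::nat))"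
    and abc: "a \<in> carrier A" "b \<in> carrier A" "c \<in> carrier A"
  \<comment> \<open>All variables from 2 onwards receive \<open>c\<close>, which keeps the range
    inside the carrier.\<close>
  show "P a b c"
    using e [rule_format, of "\<lambda>n. if n = 0 then a else if n = 1 then b else c"] abc by auto
qed (simp add: image_subset_iff)

lemma all_valuations2_iff:
  "(\<forall>e. range e \<subseteq> carrier A \<longrightarrow> P (e 0) (e (1::nat))) \<longleftrightarrow> (\<forall>a\<in>carrier A. \<forall>b\<in>carrier A. P a b)"
  using all_valuations_iff [of A "\<lambda>a b c. P a b"] by blast

lemma models_axiom_iff:
  shows "models A {Ax1} \<longleftrightarrow> (\<forall>a\<in>carrier A. \<forall>b\<in>carrier A. a \<ominus>\<^bsub>A\<^esub> (b \<ominus>\<^bsub>A\<^esub> a) = a)"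
    and "models A {Ax2} \<longleftrightarrow> (\<forall>a\<in>carrier A. \<forall>b\<in>carrier A. dr_meet A a b = dr_meet A b a)"
    and "models A {Ax3} \<longleftrightarrow> (\<forall>a\<in>carrier A. \<forall>b\<in>carrier A. \<forall>c\<in>carrier A.
           (a \<ominus>\<^bsub>A\<^esub> b) \<ominus>\<^bsub>A\<^esub> c = (a \<ominus>\<^bsub>A\<^esub> c) \<ominus>\<^bsub>A\<^esub> b)"
    and "models A {Ax4} \<longleftrightarrow> (\<forall>a\<in>carrier A. \<forall>b\<in>carrier A. \<forall>c\<in>carrier A.
           dr_meet A (a \<triangleright>\<^bsub>A\<^esub> c) (b \<triangleright>\<^bsub>A\<^esub> c) = (a \<triangleright>\<^bsub>A\<^esub> b) \<triangleright>\<^bsub>A\<^esub> c)"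
    and "models A {Ax5} \<longleftrightarrow> (\<forall>a\<in>carrier A. \<forall>b\<in>carrier A. dr_meet A a b \<triangleright>\<^bsub>A\<^esub> a = dr_meet A a b)"
  unfolding models_singleton Ax1_def Ax2_def Ax3_def Ax4_def Ax5_def Let_def sat.simps tval.simps
    dr_meet_def
  by (rule all_valuations_iff all_valuations2_iff)+

lemma models_subtraction_iff:
  assumes "dr_algebra A"
  shows "models A {Ax1, Ax2, Ax3} \<longleftrightarrow> subtraction_algebra A"
proof -
  have "models A {Ax1, Ax2, Ax3} \<longleftrightarrow> models A {Ax1} \<and> models A {Ax2} \<and> models A {Ax3}"
    by (simp add: models_insert2)
  then show ?thesis
    using assms
    unfolding models_axiom_iff subtraction_algebra_def subtraction_algebra_axioms_def by blast
qed

lemma models_difference_restriction_iff: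
  assumes "dr_algebra A"
  shows "models A {Ax1, Ax2, Ax3, Ax4, Ax5} \<longleftrightarrow> difference_restriction_algebra A"
proof -
  have "models A {Ax1, Ax2, Ax3, Ax4, Ax5} \<longleftrightarrow>
      models A {Ax1, Ax2, Ax3} \<and> models A {Ax4} \<and> models A {Ax5}"
    by (simp add: models_insert2)
  then show ?thesis
    using models_subtraction_iff [OF assms]
    unfolding models_axiom_iff(4,5) difference_restriction_algebra_def
      difference_restriction_algebra_axioms_def by blast
qed

lemma (in subtraction_algebra) models_Atomic_form_iff: "models A {Atomic_form} \<longleftrightarrow> dr_atomic A"
proof -
  have "models A {Atomic_form} \<longleftrightarrow>
    (\<forall>a\<in>carrier A. \<exists>x\<in>carrier A. \<forall>y\<in>carrier A. a \<noteq> \<zero> \<longrightarrow>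
       x \<noteq> \<zero> \<and> x \<preceq> a \<and> (y \<noteq> \<zero> \<and> y \<preceq> x \<longrightarrow> y = x))" (is "_ \<longleftrightarrow> ?R")
  proof
    show ?R if "models A {Atomic_form}"
    proof
      fix a assume "a \<in> carrier A"
      \<comment> \<open>The formula is closed, so any valuation into the carrier will do; the
        constant one is at hand.\<close>
      with that have "sat A (\<lambda>_. a) Atomic_form"
        by (auto simp: models_singleton)
      then show "\<exists>x\<in>carrier A. \<forall>y\<in>carrier A. a \<noteq> \<zero> \<longrightarrow>
          x \<noteq> \<zero> \<and> x \<preceq> a \<and> (y \<noteq> \<zero> \<and> y \<preceq> x \<longrightarrow> y = x)"
        using \<open>a \<in> carrier A\<close>
        by (auto simp: Atomic_form_def Let_def dr_le_iff dr_meet_def diff_self)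
    qed
    show "models A {Atomic_form}" if ?R
      using that
      by (auto simp: models_singleton Atomic_form_def Let_def dr_le_iff dr_meet_def diff_self)
  qed
  also have "\<dots> \<longleftrightarrow> dr_atomic A"
  proof
    show "dr_atomic A" if ?R
      unfolding dr_atomic_def dr_atom_def using that by blast
    show ?R if "dr_atomic A"
    proof
      fix a assume a: "a \<in> carrier A"
      show "\<exists>x\<in>carrier A. \<forall>y\<in>carrier A. a \<noteq> \<zero> \<longrightarrow>
          x \<noteq> \<zero> \<and> x \<preceq> a \<and> (y \<noteq> \<zero> \<and> y \<preceq> x \<longrightarrow> y = x)"
      \<comment> \<open>The prenex form asks for a witness even when \<open>a\<close> is zero; any
        element of the carrier then serves, for instance \<open>a\<close>.\<close>
      proof (cases "a = \<zero>")
        case False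
        then obtain x where "dr_atom A x" "x \<preceq> a"
          using \<open>dr_atomic A\<close> a unfolding dr_atomic_def by blast
        then show ?thesis
          by (intro bexI [of _ x]) (auto simp: dr_atom_def)
      qed (use a in blast)
    qed
  qed
  finally show ?thesis .
qed

lemma forall_exists_forall_Atomic_form: "forall_exists_forall Atomic_form"
  unfolding forall_exists_forall_def Atomic_form_def Let_def
  by (rule exI [of _ "[0]"], rule exI [of _ "[1]"], rule exI [of _ "[2]"]) auto

section \<open>Soundness\<close>

lemma representation_hom:
  assumes "representation X A \<theta>"
  shows "inj_on \<theta> (carrier A)"
    and "a \<in> carrier A \<Longrightarrow> single_valued (\<theta> a)"
    and "a \<in> carrier A \<Longrightarrow> b \<in> carrier A \<Longrightarrow> \<theta> (a \<ominus>\<^bsub>A\<^esub> b) = \<theta> a - \<theta> b"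
    and "a \<in> carrier A \<Longrightarrow> b \<in> carrier A \<Longrightarrow> \<theta> (a \<triangleright>\<^bsub>A\<^esub> b) = dom_restrict (\<theta> a) (\<theta> b)"
proof -
  obtain F where F: "\<forall>f\<in>F. partial_function_on X f" "dr_iso A (pf_algebra F) \<theta>"
    using assms unfolding representation_def algebra_of_partial_functions_def by blast
  note iso = F(2) [unfolded dr_iso_def pf_algebra_def, simplified]
  show "inj_on \<theta> (carrier A)"
    using iso by (simp add: bij_betw_def)
  show "single_valued (\<theta> a)" if "a \<in> carrier A"
    using iso that F(1) by (auto simp: bij_betw_def partial_function_on_def)
  show "\<theta> (a \<ominus>\<^bsub>A\<^esub> b) = \<theta> a - \<theta> b" "\<theta> (a \<triangleright>\<^bsub>A\<^esub> b) = dom_restrict (\<theta> a) (\<theta> b)"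
    if "a \<in> carrier A" "b \<in> carrier A"
    using iso that by auto
qed

lemma representation_imp_axioms:
  assumes "dr_algebra A" and rep: "representation X A \<theta>"
  shows "difference_restriction_algebra A"
proof -
  interpret dr_algebra A by fact
  note hom = representation_hom(3,4) [OF rep]
  have eqI: "a = b" if "\<theta> a = \<theta> b" "a \<in> carrier A" "b \<in> carrier A" for a b
    using representation_hom(1) [OF rep] that by (auto dest: inj_onD)
  show ?thesis
  proof
    fix a b assume ab: "a \<in> carrier A" "b \<in> carrier A"
    show "a \<ominus>\<^bsub>A\<^esub> (b \<ominus>\<^bsub>A\<^esub> a) = a"
      using ab by (intro eqI) (auto simp: hom diff_closed)
    show "dr_meet A a b = dr_meet A b a"
      using ab by (intro eqI) (auto simp: hom diff_closed dr_meet_def)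
    \<comment> \<open>Single-valuedness enters here: a pair of \<open>\<theta> a\<close> whose first
      coordinate is in the domain of the intersection must itself lie in the intersection.\<close>
    show "dr_meet A a b \<triangleright>\<^bsub>A\<^esub> a = dr_meet A a b"
      using ab
      by (intro eqI) (auto simp: hom diff_closed restr_closed dr_meet_def dom_restrict_def
          dest: single_valuedD [OF representation_hom(2) [OF rep]])
    fix c assume c: "c \<in> carrier A"
    show "(a \<ominus>\<^bsub>A\<^esub> b) \<ominus>\<^bsub>A\<^esub> c = (a \<ominus>\<^bsub>A\<^esub> c) \<ominus>\<^bsub>A\<^esub> b"
      using ab c by (intro eqI) (auto simp: hom diff_closed)
    show "dr_meet A (a \<triangleright>\<^bsub>A\<^esub> c) (b \<triangleright>\<^bsub>A\<^esub> c) = (a \<triangleright>\<^bsub>A\<^esub> b) \<triangleright>\<^bsub>A\<^esub> c"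
      using ab c
      by (intro eqI) (auto simp: hom diff_closed restr_closed dr_meet_def dom_restrict_def)
  qed
qed

lemma meet_complete_imp_atomic:
  assumes "dr_algebra A" and rep: "representation X A \<theta>" and mc: "meet_complete A \<theta>"
  shows "dr_atomic A"
proof -
  interpret difference_restriction_algebra A
    using representation_imp_axioms [OF assms(1) rep] .
  note hom = representation_hom(3) [OF rep]
  have zero: "\<theta> \<zero> = {}" if "a \<in> carrier A" for a
    using hom [OF that that] diff_self [OF that] by simp
  have "\<exists>m. dr_atom A m \<and> m \<preceq> a" if a: "a \<in> carrier A" "a \<noteq> \<zero>" for a
  proof -
    have "\<theta> a \<noteq> {}"
      using a zero [OF a(1)] representation_hom(1) [OF rep] zero_closed by (metis inj_onD)
    then obtain p where p: "p \<in> \<theta> a" by blast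
    define S where "S = {s \<in> carrier A. s \<preceq> a \<and> p \<in> \<theta> s}"
    have S: "S \<subseteq> carrier A" "a \<in> S"
      using a p le_refl by (auto simp: S_def)
    \<comment> \<open>Every member of \<open>S\<close> has \<open>p\<close> in its image, while
      \<open>\<theta> \<zero>\<close> is empty. Zero is a lower bound of \<open>S\<close>, so its
      failure to be the meet yields a lower bound not below zero.\<close>
    have "\<not> is_meet A S \<zero>"
    proof
      assume "is_meet A S \<zero>"
      with mc S have "\<theta> \<zero> = \<Inter> (\<theta> ` S)"
        unfolding meet_complete_def by blast
      then show False
        using zero [OF a(1)] by (auto simp: S_def)
    qed
    then obtain m where m: "m \<in> carrier A" "\<forall>s\<in>S. m \<preceq> s" "\<not> m \<preceq> \<zero>"
      using S(1) a(1) zero_closed zero_le unfolding is_meet_iff [OF S(1)] by blast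
    have ma: "m \<preceq> a"
      using m S by blast
    have "y = m" if y: "y \<in> carrier A" "y \<noteq> \<zero>" "y \<preceq> m" for y
    \<comment> \<open>Either \<open>y\<close> or \<open>a \<ominus> y\<close> contains
      \<open>p\<close> in its image and so belongs to \<open>S\<close>. In the first case
      \<open>m \<preceq> y\<close>; in the second
      \<open>y \<preceq> m \<preceq> a \<ominus> y\<close>, so \<open>y\<close> is disjoint from
      itself, contrary to being nonzero.\<close>
    proof (cases "p \<in> \<theta> y")
      case True
      then have "y \<in> S"
        using y m ma a le_trans unfolding S_def by blast
      then show ?thesis
        using m y le_antisym by blast
    next
      case False
      then have "a \<ominus>\<^bsub>A\<^esub> y \<in> S"
        using y a p by (simp add: S_def hom diff_closed diff_le)
      then have "y \<preceq> a \<ominus>\<^bsub>A\<^esub> y"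
        using m y a le_trans diff_closed by blast
      then have "y \<sqinter> y = \<zero>"
        using y a le_diff_iff by blast
      then show ?thesis
        using y le_refl dr_le_iff by metis
    qed
    then show ?thesis
      using m ma le_zero by (auto simp: dr_atom_def)
  qed
  then show ?thesis
    by (auto simp: dr_atomic_def)
qed

lemma completely_representable_imp_atomic:
  assumes "dr_algebra A" "completely_representable TYPE('x) A"
  shows "difference_restriction_algebra A \<and> dr_atomic A"
  using assms representation_imp_axioms meet_complete_imp_atomic
  unfolding completely_representable_def complete_representation_def by blast

text \<open>A complete representation over any type of points yields the axioms and atomicity, and
  these yield the representation by atoms, whose points are elements of \<open>A\<close>. Hence
  fixing the point type \<open>'a\<close> loses no algebra.\<close>

theorem theorem6p16:
  fixes A :: "'a dr_algebra"
  assumes "dr_algebra A"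
  shows "(completely_representable TYPE('a) A \<longleftrightarrow>
            models A {Ax1, Ax2, Ax3, Ax4, Ax5, Atomic_form})
       \<and> (completely_representable TYPE('x) A \<longrightarrow> completely_representable TYPE('a) A)
       \<and> forall_exists_forall Atomic_form
       \<and> (models A {Ax1, Ax2, Ax3} \<longrightarrow> (models A {Atomic_form} \<longleftrightarrow> dr_atomic A))"
proof -
  have atomic: "models A {Ax1, Ax2, Ax3} \<longrightarrow> (models A {Atomic_form} \<longleftrightarrow> dr_atomic A)"
    using models_subtraction_iff [OF assms] subtraction_algebra.models_Atomic_form_iff by blast
  have "models A {Ax1, Ax2, Ax3, Ax4, Ax5, Atomic_form} \<longleftrightarrow>
      models A {Ax1, Ax2, Ax3, Ax4, Ax5} \<and> models A {Atomic_form}"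
    by (simp add: models_insert2)
  then have axioms: "models A {Ax1, Ax2, Ax3, Ax4, Ax5, Atomic_form} \<longleftrightarrow>
      difference_restriction_algebra A \<and> dr_atomic A"
    using atomic models_subtraction_iff [OF assms] models_difference_restriction_iff [OF assms]
      difference_restriction_algebra.axioms(1) by blast
  have complete: "completely_representable TYPE('a) A"
    if "difference_restriction_algebra A" "dr_atomic A"
  proof -
    interpret difference_restriction_algebra A by fact
    show ?thesis
      unfolding completely_representable_def complete_representation_def
      using representation_atom_rep [OF that(2)] meet_complete_atom_rep join_complete_atom_rep
      by blast
  qed
  show ?thesis
    using atomic axioms complete forall_exists_forall_Atomic_form
      completely_representable_imp_atomic [OF assms, where 'x = 'a]
      completely_representable_imp_atomic [OF assms, where 'x = 'x]
    by blast
qed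

end
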